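(* Let $K$ be a number field. There exists a bijective correspondence between the maximal ideals $\mathfrak{p} \in P_K$ of $O_K$ and the maximal idempotents of the Deligne-Ribet monoid $DR_K$.
   Context: For a number field $K$ with ring of integers $O_K$: $P_K$ is the set of maximal ideals of $O_K$; $O_{\mathfrak{p}}$ is the completion of $O_K$ at $\mathfrak{p}$; $\hat{O}_K = \prod_{\mathfrak{p} \in P_K} O_{\mathfrak{p}}$ is the profinite completion of $O_K$; $G_K^{ab}$ is the Galois group of the maximal abelian extension of $K$; $\mathrm{rec}: \mathbb{A}_{K,f}^\times \to G_K^{ab}$ is the restriction of the global Artin reciprocity map to finite ideles (extended by $1$ at the archimedean places). The Deligne-Ribet monoid of $K$ is the profinite (commutative topological) monoid $$DR_K = \hat{O}_K \times_{\hat{O}_K^\times} G_K^{ab},$$ the quotient of the multiplicative monoid $\hat{O}_K \times G_K^{ab}$ by the relation $(\rho, s) \sim (\rho u, \mathrm{rec}(u)^{-1} s)$ for $u \in \hat{O}_K^\times$, with componentwise multiplication and the quotient topology. Idempotents of $DR_K$ are partially ordered by $e \leq e'$ if and only if $e \cdot e' = e$. An idempotent $e$ is called maximal if (i) $e \neq 1$ and (ii) $e \leq e'$ implies $e' = e$ or $e' = 1$, for every idempotent $e'$. *)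

theory Defs
  imports
    "HOL-Analysis.Analysis"
    "HOL-Algebra.Algebra"
    "HOL-Algebra.Algebraic_Closure_Type"
begin

section \<open>Number fields and their maximal ideals\<close>

class number_field = field_char_0 +
  assumes finite_over_Rats:
    "\<exists>B. finite B \<and> (\<forall>x. \<exists>c. (\<forall>b\<in>B. c b \<in> \<rat>) \<and> x = (\<Sum>b\<in>B. c b * b))"

instance rat :: number_field
proof
  show "\<exists>B. finite B \<and> (\<forall>x::rat. \<exists>c. (\<forall>b\<in>B. c b \<in> \<rat>) \<and> x = (\<Sum>b\<in>B. c b * b))"
  proof (rule exI[of _ "{1}"], intro conjI allI)
    fix x :: rat
    show "\<exists>c. (\<forall>b\<in>{1}. c b \<in> \<rat>) \<and> x = (\<Sum>b\<in>{1}. c b * b)"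
      by (rule exI[of _ "\<lambda>_. x"]) (simp add: Rats_def)
  qed simp
qed

definition int_ring :: "'a::field set \<Rightarrow> 'a ring" where
  "int_ring L = ring_of_type_algebra\<lparr>carrier := {x \<in> L. algebraic_int x}\<rparr>"

text \<open>The number field \<open>K\<close> is the whole type \<open>'k\<close>.\<close>

abbreviation OK :: "'k::number_field ring" where
  "OK \<equiv> int_ring UNIV"

definition maximal_ideals :: "'k::number_field set set" where
  "maximal_ideals = {\<pp>. maximalideal \<pp> OK}"

abbreviation ideal_power :: "('a, 'b) ring_scheme \<Rightarrow> 'a set \<Rightarrow> nat \<Rightarrow> 'a set" where
  "ideal_power R I n \<equiv> I [^]\<^bsub>ideals_set R\<^esub> n"

section \<open>Completions and the profinite completion of the ring of integers\<close>

definition ring_prod :: "'i set \<Rightarrow> ('i \<Rightarrow> ('a, 'b) ring_scheme) \<Rightarrow> ('i \<Rightarrow> 'a) ring" where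
  "ring_prod I R =
    \<lparr>carrier = (\<Pi>\<^sub>E i\<in>I. carrier (R i)),
     monoid.mult = (\<lambda>x y. \<lambda>i\<in>I. x i \<otimes>\<^bsub>R i\<^esub> y i),
     one = (\<lambda>i\<in>I. \<one>\<^bsub>R i\<^esub>),
     ring.zero = (\<lambda>i\<in>I. \<zero>\<^bsub>R i\<^esub>),
     add = (\<lambda>x y. \<lambda>i\<in>I. x i \<oplus>\<^bsub>R i\<^esub> y i)\<rparr>"

text \<open>The completion of \<open>OK\<close> at \<open>\<pp>\<close> is the inverse limit of the rings \<open>OK/\<pp>\<^sup>n\<close>. Elements of
  \<open>OK/\<pp>\<^sup>n\<close> are cosets, and a coset of \<open>\<pp>\<^sup>n\<^sup>+\<^sup>1\<close> reduces to the coset of \<open>\<pp>\<^sup>n\<close> containing it.\<close>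

definition residue_ring_pow :: "'k::number_field set \<Rightarrow> nat \<Rightarrow> 'k set ring" where
  "residue_ring_pow \<pp> n = OK Quot (ideal_power OK \<pp> n)"

definition Op :: "'k::number_field set \<Rightarrow> (nat \<Rightarrow> 'k set) ring" where
  "Op \<pp> = (ring_prod UNIV (residue_ring_pow \<pp>))
     \<lparr>carrier := {x. (\<forall>n. x n \<in> carrier (residue_ring_pow \<pp> n)) \<and> (\<forall>n. x (Suc n) \<subseteq> x n)}\<rparr>"

definition Op_topology :: "'k::number_field set \<Rightarrow> (nat \<Rightarrow> 'k set) topology" where
  "Op_topology \<pp> =
     subtopology (product_topology (\<lambda>n. discrete_topology (carrier (residue_ring_pow \<pp> n))) UNIV)
       (carrier (Op \<pp>))"

definition Ohat :: "('k::number_field set \<Rightarrow> nat \<Rightarrow> 'k set) ring" where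
  "Ohat = ring_prod maximal_ideals Op"

definition Ohat_topology :: "('k::number_field set \<Rightarrow> nat \<Rightarrow> 'k set) topology" where
  "Ohat_topology = product_topology Op_topology maximal_ideals"

definition to_Op :: "'k::number_field set \<Rightarrow> 'k \<Rightarrow> nat \<Rightarrow> 'k set" where
  "to_Op \<pp> a = (\<lambda>n. ideal_power OK \<pp> n +>\<^bsub>OK\<^esub> a)"

section \<open>Finite adeles\<close>

text \<open>Total ring of fractions of a commutative ring: the denominators are the elements that are
  not zero divisors. For an integral domain, such as \<open>Op \<pp>\<close>, this is the field of fractions.\<close>

definition nonzerodivisors :: "('a, 'b) ring_scheme \<Rightarrow> 'a set" where
  "nonzerodivisors R =
     {s \<in> carrier R. \<forall>a\<in>carrier R. s \<otimes>\<^bsub>R\<^esub> a = \<zero>\<^bsub>R\<^esub> \<longrightarrow> a = \<zero>\<^bsub>R\<^esub>}"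

definition frac_rel :: "('a, 'b) ring_scheme \<Rightarrow> (('a \<times> 'a) \<times> ('a \<times> 'a)) set" where
  "frac_rel R = {((a, s), (b, t)). a \<in> carrier R \<and> s \<in> nonzerodivisors R \<and>
     b \<in> carrier R \<and> t \<in> nonzerodivisors R \<and> a \<otimes>\<^bsub>R\<^esub> t = b \<otimes>\<^bsub>R\<^esub> s}"

definition fraction :: "('a, 'b) ring_scheme \<Rightarrow> 'a \<Rightarrow> 'a \<Rightarrow> ('a \<times> 'a) set" where
  "fraction R a s = frac_rel R `` {(a, s)}"

definition frac_ring :: "('a, 'b) ring_scheme \<Rightarrow> ('a \<times> 'a) set ring" where
  "frac_ring R =
    \<lparr>carrier = (carrier R \<times> nonzerodivisors R) // frac_rel R,
     monoid.mult = (\<lambda>C D. \<Union>(a, s)\<in>C. \<Union>(b, t)\<in>D. fraction R (a \<otimes>\<^bsub>R\<^esub> b) (s \<otimes>\<^bsub>R\<^esub> t)),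
     one = fraction R \<one>\<^bsub>R\<^esub> \<one>\<^bsub>R\<^esub>,
     ring.zero = fraction R \<zero>\<^bsub>R\<^esub> \<one>\<^bsub>R\<^esub>,
     add = (\<lambda>C D. \<Union>(a, s)\<in>C. \<Union>(b, t)\<in>D.
       fraction R (a \<otimes>\<^bsub>R\<^esub> t \<oplus>\<^bsub>R\<^esub> b \<otimes>\<^bsub>R\<^esub> s) (s \<otimes>\<^bsub>R\<^esub> t))\<rparr>"

type_synonym 'k local_elt = "((nat \<Rightarrow> 'k set) \<times> (nat \<Rightarrow> 'k set)) set"

definition Kp :: "'k::number_field set \<Rightarrow> 'k local_elt ring" where
  "Kp \<pp> = frac_ring (Op \<pp>)"

definition Op_to_Kp :: "'k::number_field set \<Rightarrow> (nat \<Rightarrow> 'k set) \<Rightarrow> 'k local_elt" where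
  "Op_to_Kp \<pp> a = fraction (Op \<pp>) a \<one>\<^bsub>Op \<pp>\<^esub>"

definition finite_adeles :: "('k::number_field set \<Rightarrow> 'k local_elt) ring" where
  "finite_adeles = (ring_prod maximal_ideals Kp)
     \<lparr>carrier := {x \<in> \<Pi>\<^sub>E \<pp>\<in>maximal_ideals. carrier (Kp \<pp>).
        finite {\<pp> \<in> maximal_ideals. x \<pp> \<notin> Op_to_Kp \<pp> ` carrier (Op \<pp>)}}\<rparr>"

definition Ohat_to_adeles ::
    "('k::number_field set \<Rightarrow> nat \<Rightarrow> 'k set) \<Rightarrow> 'k set \<Rightarrow> 'k local_elt" where
  "Ohat_to_adeles u = (\<lambda>\<pp>\<in>maximal_ideals. Op_to_Kp \<pp> (u \<pp>))"

text \<open>The restricted product topology on the finite ideles: the unit group of \<open>Ohat\<close>, with its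
  profinite topology, is an open topological subgroup. As \<open>Ohat\<close> is compact, inversion on its
  units is continuous for the subspace topology.\<close>

definition finite_idele_topology :: "('k::number_field set \<Rightarrow> 'k local_elt) topology" where
  "finite_idele_topology = topology (\<lambda>U. U \<subseteq> Units finite_adeles \<and>
     (\<forall>x\<in>Units finite_adeles. openin (subtopology Ohat_topology (Units Ohat))
        {u \<in> Units Ohat. x \<otimes>\<^bsub>finite_adeles\<^esub> Ohat_to_adeles u \<in> U}))"

lemma istopology_preimages:
  "istopology (\<lambda>U. U \<subseteq> A \<and> (\<forall>x\<in>I. openin T {u \<in> B x. f x u \<in> U}))"
  unfolding istopology_def
proof (intro conjI allI impI ballI)
  fix U V x
  assume U: "U \<subseteq> A \<and> (\<forall>x\<in>I. openin T {u \<in> B x. f x u \<in> U})"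
    and V: "V \<subseteq> A \<and> (\<forall>x\<in>I. openin T {u \<in> B x. f x u \<in> V})"
  show "U \<inter> V \<subseteq> A" using U by blast
  assume "x \<in> I"
  moreover have "{u \<in> B x. f x u \<in> U \<inter> V} = {u \<in> B x. f x u \<in> U} \<inter> {u \<in> B x. f x u \<in> V}"
    by blast
  ultimately show "openin T {u \<in> B x. f x u \<in> U \<inter> V}"
    using U V by (simp add: openin_Int)
next
  fix \<K> x
  assume K: "\<forall>U\<in>\<K>. U \<subseteq> A \<and> (\<forall>x\<in>I. openin T {u \<in> B x. f x u \<in> U})"
  show "\<Union>\<K> \<subseteq> A" using K by blast
  assume "x \<in> I"
  moreover have "{u \<in> B x. f x u \<in> \<Union>\<K>} = (\<Union>U\<in>\<K>. {u \<in> B x. f x u \<in> U})"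
    by blast
  ultimately show "openin T {u \<in> B x. f x u \<in> \<Union>\<K>}"
    using K by (simp only:) (intro openin_Union, blast)
qed

lemma openin_finite_idele_topology:
  "openin finite_idele_topology U \<longleftrightarrow> U \<subseteq> Units finite_adeles \<and>
     (\<forall>x\<in>Units finite_adeles. openin (subtopology Ohat_topology (Units Ohat))
        {u \<in> Units Ohat. x \<otimes>\<^bsub>finite_adeles\<^esub> Ohat_to_adeles u \<in> U})"
  unfolding finite_idele_topology_def
  by (subst topology_inverse'[OF istopology_preimages]) (rule refl)

section \<open>Ideles\<close>

definition embeddings :: "('k::number_field \<Rightarrow> complex) set" where
  "embeddings = ring_hom ring_of_type_algebra ring_of_type_algebra"

text \<open>The product of the archimedean completions of \<open>K\<close>, in the form of the Minkowski space: the
  families of complex numbers indexed by the embeddings \<open>\<sigma>\<close> that are compatible with complex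
  conjugation. A real place contributes one real coordinate, and the two coordinates of a complex
  place determine each other.\<close>

definition K_infinity :: "(('k::number_field \<Rightarrow> complex) \<Rightarrow> complex) ring" where
  "K_infinity = (ring_prod embeddings (\<lambda>_. ring_of_type_algebra))
     \<lparr>carrier := {x \<in> embeddings \<rightarrow>\<^sub>E UNIV. \<forall>\<sigma>\<in>embeddings. x (\<lambda>a. cnj (\<sigma> a)) = cnj (x \<sigma>)}\<rparr>"

type_synonym 'k idele = "('k set \<Rightarrow> 'k local_elt) \<times> (('k \<Rightarrow> complex) \<Rightarrow> complex)"

definition ideles :: "'k::number_field idele monoid" where
  "ideles = units_of (RDirProd finite_adeles K_infinity)"

definition idele_topology :: "'k::number_field idele topology" where
  "idele_topology = prod_topology finite_idele_topology
     (subtopology (product_topology (\<lambda>_. euclidean) embeddings) (Units K_infinity))"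

text \<open>Elements of \<open>K\<^sup>\<times>\<close> are written as quotients of nonzero integers.\<close>

definition principal_ideles :: "'k::number_field idele set" where
  "principal_ideles =
     {(\<lambda>\<pp>\<in>maximal_ideals. fraction (Op \<pp>) (to_Op \<pp> a) (to_Op \<pp> b), \<lambda>\<sigma>\<in>embeddings. \<sigma> (a / b)) | a b.
        a \<in> carrier OK \<and> b \<in> carrier OK \<and> a \<noteq> 0 \<and> b \<noteq> 0}"

definition local_idele :: "'k::number_field set \<Rightarrow> 'k local_elt \<Rightarrow> 'k idele" where
  "local_idele \<pp> x =
     (\<lambda>\<qq>\<in>maximal_ideals. if \<qq> = \<pp> then x else \<one>\<^bsub>Kp \<qq>\<^esub>, \<one>\<^bsub>K_infinity\<^esub>)"

definition uniformizer :: "'k::number_field set \<Rightarrow> (nat \<Rightarrow> 'k set) \<Rightarrow> bool" where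
  "uniformizer \<pp> \<pi> \<longleftrightarrow> \<pi> \<in> carrier (Op \<pp>) \<and>
     \<pi> 1 = \<zero>\<^bsub>residue_ring_pow \<pp> 1\<^esub> \<and> \<pi> 2 \<noteq> \<zero>\<^bsub>residue_ring_pow \<pp> 2\<^esub>"

section \<open>The Galois group of the maximal abelian extension\<close>

definition galois_group :: "'a::field set \<Rightarrow> 'a set \<Rightarrow> ('a \<Rightarrow> 'a) monoid" where
  "galois_group F E = (BijGroup E)
     \<lparr>carrier := {\<sigma> \<in> Bij E.
        \<sigma> \<in> ring_hom (ring_of_type_algebra\<lparr>carrier := E\<rparr>) (ring_of_type_algebra\<lparr>carrier := E\<rparr>) \<and>
        (\<forall>x\<in>F. \<sigma> x = x)}\<rparr>"

abbreviation base_field :: "'k::number_field alg_closure set" where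
  "base_field \<equiv> range to_ac"

definition finite_abelian_extension :: "'k::number_field alg_closure set \<Rightarrow> bool" where
  "finite_abelian_extension L \<longleftrightarrow>
     subfield L ring_of_type_algebra \<and> base_field \<subseteq> L \<and>
     ring.finite_dimension ring_of_type_algebra base_field L \<and>
     {x \<in> L. \<forall>\<sigma>\<in>carrier (galois_group base_field L). \<sigma> x = x} = base_field \<and>
     comm_group (galois_group base_field L)"

definition Kab :: "'k::number_field alg_closure set" where
  "Kab = generate_field ring_of_type_algebra (\<Union>{L. finite_abelian_extension L})"

type_synonym 'k gal_elt = "'k alg_closure \<Rightarrow> 'k alg_closure"

definition Gab :: "'k::number_field gal_elt monoid" where
  "Gab = galois_group base_field Kab"

text \<open>The Krull topology is the topology of pointwise convergence on the discrete set \<open>Kab\<close>.\<close>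

definition Gab_topology :: "'k::number_field gal_elt topology" where
  "Gab_topology = subtopology (product_topology (\<lambda>_. discrete_topology Kab) Kab) (carrier Gab)"

section \<open>The global Artin reciprocity map\<close>

definition primes_above ::
    "'k::number_field set \<Rightarrow> 'k alg_closure set \<Rightarrow> 'k alg_closure set set" where
  "primes_above \<pp> L = {\<PP>. maximalideal \<PP> (int_ring L) \<and> to_ac ` \<pp> \<subseteq> \<PP>}"

definition unramified :: "'k::number_field set \<Rightarrow> 'k alg_closure set \<Rightarrow> bool" where
  "unramified \<pp> L \<longleftrightarrow>
     (\<forall>\<PP>\<in>primes_above \<pp> L. \<not> to_ac ` \<pp> \<subseteq> ideal_power (int_ring L) \<PP> 2)"

text \<open>By class field theory exactly one map satisfies the following conditions. Its normalisation
  sends uniformizers to arithmetic Frobenius elements.\<close>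

definition global_artin_map :: "('k::number_field idele \<Rightarrow> 'k gal_elt) \<Rightarrow> bool" where
  "global_artin_map artin \<longleftrightarrow>
     artin \<in> hom ideles Gab \<and>
     continuous_map idele_topology Gab_topology artin \<and>
     (\<forall>x\<in>principal_ideles. artin x = \<one>\<^bsub>Gab\<^esub>) \<and>
     (\<forall>L \<pp> \<pi>. finite_abelian_extension L \<longrightarrow> \<pp> \<in> maximal_ideals \<longrightarrow> unramified \<pp> L \<longrightarrow>
        uniformizer \<pp> \<pi> \<longrightarrow>
        (\<forall>\<PP>\<in>primes_above \<pp> L. \<forall>y\<in>carrier (int_ring L).
           artin (local_idele \<pp> (Op_to_Kp \<pp> \<pi>)) y - y ^ card (carrier (OK Quot \<pp>)) \<in> \<PP>))"

definition finite_rec ::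
    "('k::number_field idele \<Rightarrow> 'k gal_elt) \<Rightarrow> ('k set \<Rightarrow> 'k local_elt) \<Rightarrow> 'k gal_elt" where
  "finite_rec artin x = artin (x, \<one>\<^bsub>K_infinity\<^esub>)"

section \<open>The Deligne-Ribet monoid\<close>

type_synonym 'k DR_pair = "('k set \<Rightarrow> nat \<Rightarrow> 'k set) \<times> 'k gal_elt"

definition DR_rel ::
    "('k::number_field idele \<Rightarrow> 'k gal_elt) \<Rightarrow> ('k DR_pair \<times> 'k DR_pair) set" where
  "DR_rel artin =
     {((\<rho>, s), (\<rho> \<otimes>\<^bsub>Ohat\<^esub> u, inv\<^bsub>Gab\<^esub> (finite_rec artin (Ohat_to_adeles u)) \<otimes>\<^bsub>Gab\<^esub> s)) | \<rho> s u.
        \<rho> \<in> carrier Ohat \<and> s \<in> carrier Gab \<and> u \<in> Units Ohat}"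

definition DR :: "('k::number_field idele \<Rightarrow> 'k gal_elt) \<Rightarrow> 'k DR_pair set monoid" where
  "DR artin =
    \<lparr>carrier = carrier (Ohat \<times>\<times> Gab) // DR_rel artin,
     monoid.mult = (\<lambda>C D. \<Union>x\<in>C. \<Union>y\<in>D. DR_rel artin `` {x \<otimes>\<^bsub>Ohat \<times>\<times> Gab\<^esub> y}),
     one = DR_rel artin `` {\<one>\<^bsub>Ohat \<times>\<times> Gab\<^esub>}\<rparr>"

definition DR_topology ::
    "('k::number_field idele \<Rightarrow> 'k gal_elt) \<Rightarrow> 'k DR_pair set topology" where
  "DR_topology artin = topology (\<lambda>U. U \<subseteq> carrier (DR artin) \<and>
     openin (prod_topology Ohat_topology Gab_topology)
       {x \<in> carrier (Ohat \<times>\<times> Gab). DR_rel artin `` {x} \<in> U})"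

lemma openin_DR_topology:
  "openin (DR_topology artin) U \<longleftrightarrow> U \<subseteq> carrier (DR artin) \<and>
     openin (prod_topology Ohat_topology Gab_topology)
       {x \<in> carrier (Ohat \<times>\<times> Gab). DR_rel artin `` {x} \<in> U}"
  using istopology_preimages[of "carrier (DR artin)" "{()}"
    "prod_topology Ohat_topology Gab_topology" "\<lambda>_. carrier (Ohat \<times>\<times> Gab)"
    "\<lambda>_ x. DR_rel artin `` {x}"]
  unfolding DR_topology_def by (subst topology_inverse') simp_all

section \<open>Maximal idempotents\<close>

definition idempotents :: "('a, 'b) monoid_scheme \<Rightarrow> 'a set" where
  "idempotents M = {e \<in> carrier M. e \<otimes>\<^bsub>M\<^esub> e = e}"

definition idem_le :: "('a, 'b) monoid_scheme \<Rightarrow> 'a \<Rightarrow> 'a \<Rightarrow> bool" where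
  "idem_le M e e' \<longleftrightarrow> e \<otimes>\<^bsub>M\<^esub> e' = e"

definition maximal_idempotents :: "('a, 'b) monoid_scheme \<Rightarrow> 'a set" where
  "maximal_idempotents M =
     {e \<in> idempotents M. e \<noteq> \<one>\<^bsub>M\<^esub> \<and>
        (\<forall>e'\<in>idempotents M. idem_le M e e' \<longrightarrow> e' = e \<or> e' = \<one>\<^bsub>M\<^esub>)}"

end

theory Submission
  imports Defs
begin

text \<open>Idempotents of the Deligne-Ribet monoid are the classes of \<open>(\<epsilon>, 1)\<close> with \<open>\<epsilon>\<close> an idempotent of
  \<open>Ohat\<close>: if \<open>(\<rho>\<^sup>2, s\<^sup>2) \<sim> (\<rho>, s)\<close>, then \<open>s\<close> is the inverse of the image of a unit, which can be moved
  to the first component. Idempotents of \<open>Ohat\<close> that differ by a unit are equal, so the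
  correspondence is an isomorphism of ordered sets. Each \<open>O\<^sub>\<pp>\<close> has only the idempotents \<open>0\<close> and
  \<open>1\<close>, so the idempotents of \<open>Ohat\<close> are the indicator functions of sets of maximal ideals, and
  the maximal ones vanish at exactly one maximal ideal.\<close>

section \<open>Direct products of commutative rings\<close>

lemma ring_prod_simps:
  "carrier (ring_prod I R) = (\<Pi>\<^sub>E i\<in>I. carrier (R i))"
  "x \<otimes>\<^bsub>ring_prod I R\<^esub> y = (\<lambda>i\<in>I. x i \<otimes>\<^bsub>R i\<^esub> y i)"
  "\<one>\<^bsub>ring_prod I R\<^esub> = (\<lambda>i\<in>I. \<one>\<^bsub>R i\<^esub>)"
  "\<zero>\<^bsub>ring_prod I R\<^esub> = (\<lambda>i\<in>I. \<zero>\<^bsub>R i\<^esub>)"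
  "x \<oplus>\<^bsub>ring_prod I R\<^esub> y = (\<lambda>i\<in>I. x i \<oplus>\<^bsub>R i\<^esub> y i)"
  by (simp_all add: ring_prod_def)

lemma ring_prod_cring:
  assumes "\<And>i. i \<in> I \<Longrightarrow> cring (R i)"
  shows "cring (ring_prod I R)"
proof (rule cringI)
  have mem: "x i \<in> carrier (R i)" if "x \<in> (\<Pi>\<^sub>E i\<in>I. carrier (R i))" "i \<in> I" for x i
    using that by (rule PiE_mem)
  note [simp] = ring_prod_simps cring.cring_simprules[OF assms] mem
    monoid.r_one[OF ring.is_monoid[OF cring.axioms(1)[OF assms]]]
  note [intro!] = PiE_ext[of _ I "\<lambda>i. carrier (R i)"]
  show "abelian_group (ring_prod I R)"
  proof (rule abelian_groupI)
    fix x assume x: "x \<in> carrier (ring_prod I R)"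
    then show "\<exists>y\<in>carrier (ring_prod I R). y \<oplus>\<^bsub>ring_prod I R\<^esub> x = \<zero>\<^bsub>ring_prod I R\<^esub>"
      by (intro bexI[of _ "\<lambda>i\<in>I. \<ominus>\<^bsub>R i\<^esub> x i"]) auto
  qed auto
  show "comm_monoid (ring_prod I R)"
    by (rule comm_monoidI) auto
  show "(x \<oplus>\<^bsub>ring_prod I R\<^esub> y) \<otimes>\<^bsub>ring_prod I R\<^esub> z =
      x \<otimes>\<^bsub>ring_prod I R\<^esub> z \<oplus>\<^bsub>ring_prod I R\<^esub> y \<otimes>\<^bsub>ring_prod I R\<^esub> z"
    if "x \<in> carrier (ring_prod I R)" "y \<in> carrier (ring_prod I R)" "z \<in> carrier (ring_prod I R)"
    for x y z
    using that by auto
qed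

section \<open>Idempotents of a product of connected rings\<close>

text \<open>Connectedness turns idempotents into zero-one families, ordered by inclusion of the sets
  of indices where they are one. The maximal proper subsets of \<open>I\<close> omit a single index,
  and \<open>nontriv\<close> keeps the resulting families distinct from each other and from
  one.\<close>

lemma bij_betw_maximal_idempotents_ring_prod:
  assumes cr: "\<And>i. i \<in> I \<Longrightarrow> cring (R i)"
    and nontriv: "\<And>i. i \<in> I \<Longrightarrow> \<one>\<^bsub>R i\<^esub> \<noteq> \<zero>\<^bsub>R i\<^esub>"
    and conn: "\<And>i e. \<lbrakk>i \<in> I; e \<in> idempotents (R i)\<rbrakk> \<Longrightarrow> e = \<zero>\<^bsub>R i\<^esub> \<or> e = \<one>\<^bsub>R i\<^esub>"
  shows "bij_betw (\<lambda>j. \<lambda>i\<in>I. if i = j then \<zero>\<^bsub>R i\<^esub> else \<one>\<^bsub>R i\<^esub>) I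
    (maximal_idempotents (ring_prod I R))"
    (is "bij_betw ?e I (maximal_idempotents ?P)")
proof (rule bij_betw_imageI)
  note [simp] = ring_prod_simps cring.cring_simprules[OF cr] nontriv nontriv[symmetric]
  have idem: "e \<in> idempotents ?P \<longleftrightarrow>
      e \<in> extensional I \<and> (\<forall>i\<in>I. e i = \<zero>\<^bsub>R i\<^esub> \<or> e i = \<one>\<^bsub>R i\<^esub>)" for e
  proof
    assume e: "e \<in> idempotents ?P"
    have "e i \<in> idempotents (R i)" if "i \<in> I" for i
    proof -
      have "(e \<otimes>\<^bsub>?P\<^esub> e) i = e i"
        using e by (simp only: idempotents_def mem_Collect_eq)
      then show ?thesis
        using e that by (auto simp: idempotents_def)
    qed
    then show "e \<in> extensional I \<and> (\<forall>i\<in>I. e i = \<zero>\<^bsub>R i\<^esub> \<or> e i = \<one>\<^bsub>R i\<^esub>)"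
      using e conn by (auto simp: idempotents_def PiE_def)
  next
    assume e: "e \<in> extensional I \<and> (\<forall>i\<in>I. e i = \<zero>\<^bsub>R i\<^esub> \<or> e i = \<one>\<^bsub>R i\<^esub>)"
    then have "e i \<in> carrier (R i)" "e i \<otimes>\<^bsub>R i\<^esub> e i = e i" if "i \<in> I" for i
      using that by fastforce+
    moreover from this e have "e \<otimes>\<^bsub>?P\<^esub> e = e"
      by (intro extensionalityI[of _ I]) simp_all
    ultimately show "e \<in> idempotents ?P"
      using e by (auto simp: idempotents_def PiE_def)
  qed
  have e_idem: "?e j \<in> idempotents ?P" for j
    by (simp add: idem)
  show "inj_on ?e I"
  proof (rule inj_onI)
    fix j k assume "j \<in> I" "k \<in> I" "?e j = ?e k"
    then have "?e j j = ?e k j"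
      by simp
    then show "j = k"
      using \<open>j \<in> I\<close> by (simp split: if_splits)
  qed
  have e_neq_one: "?e j \<noteq> \<one>\<^bsub>?P\<^esub>" if "j \<in> I" for j
  proof
    assume "?e j = \<one>\<^bsub>?P\<^esub>"
    then have "?e j j = \<one>\<^bsub>?P\<^esub> j"
      by simp
    then show False
      using that by simp
  qed
  show "?e ` I = maximal_idempotents ?P"
  proof (intro subset_antisym subsetI)
    fix e assume "e \<in> ?e ` I"
    then obtain j where j: "j \<in> I" and e: "e = ?e j" by blast
    have "e' = e \<or> e' = \<one>\<^bsub>?P\<^esub>" if e': "e' \<in> idempotents ?P" and le: "idem_le ?P e e'" for e'
    proof -
      have ext: "e' \<in> extensional I"
        and val: "\<And>i. i \<in> I \<Longrightarrow> e' i = \<zero>\<^bsub>R i\<^esub> \<or> e' i = \<one>\<^bsub>R i\<^esub>"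
        using e' by (auto simp: idem)
      \<comment> \<open>Where \<open>e\<close> is one, the equation \<open>e e' = e\<close> forces
        \<open>e'\<close> to be one as well; only the value at \<open>j\<close> stays free.\<close>
      have off_j: "e' i = \<one>\<^bsub>R i\<^esub>" if "i \<in> I" "i \<noteq> j" for i
      proof -
        have "(e \<otimes>\<^bsub>?P\<^esub> e') i = e i"
          using le by (simp only: idem_le_def)
        then show ?thesis
          using that val[of i] by (auto simp: e)
      qed
      show ?thesis
      proof (cases "e' j = \<zero>\<^bsub>R j\<^esub>")
        case True
        then have "e' = e"
          using ext off_j by (intro extensionalityI[of _ I]) (auto simp: e)
        then show ?thesis ..
      next
        case False
        then have "e' i = \<one>\<^bsub>R i\<^esub>" if "i \<in> I" for i
          using off_j val that by (cases "i = j") auto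
        then have "e' = \<one>\<^bsub>?P\<^esub>"
          using ext by (intro extensionalityI[of _ I]) auto
        then show ?thesis ..
      qed
    qed
    then show "e \<in> maximal_idempotents ?P"
      using e_idem e_neq_one[OF j] unfolding e maximal_idempotents_def by blast
  next
    fix e assume e: "e \<in> maximal_idempotents ?P"
    then have ext: "e \<in> extensional I"
      and val: "\<And>i. i \<in> I \<Longrightarrow> e i = \<zero>\<^bsub>R i\<^esub> \<or> e i = \<one>\<^bsub>R i\<^esub>"
      by (auto simp: maximal_idempotents_def idem)
    have "\<exists>j\<in>I. e j \<noteq> \<one>\<^bsub>R j\<^esub>"
    proof (rule ccontr)
      assume "\<not> ?thesis"
      then have "e = \<one>\<^bsub>?P\<^esub>"
        using ext by (intro extensionalityI[of _ I]) auto
      then show False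
        using e unfolding maximal_idempotents_def by blast
    qed
    then obtain j where j: "j \<in> I" and e_j: "e j = \<zero>\<^bsub>R j\<^esub>"
      using val by blast
    \<comment> \<open>As \<open>e\<close> vanishes at \<open>j\<close>, it lies below
      \<open>?e j\<close>; since \<open>?e j\<close> is not one, maximality of \<open>e\<close>
      gives equality.\<close>
    have "e \<otimes>\<^bsub>?P\<^esub> ?e j = e"
    proof (rule extensionalityI[of _ I])
      fix i assume "i \<in> I"
      then show "(e \<otimes>\<^bsub>?P\<^esub> ?e j) i = e i"
        using val[of i] e_j by auto
    qed (use ext in simp_all)
    then have "?e j = e"
      using e e_idem e_neq_one[OF j] unfolding maximal_idempotents_def idem_le_def by blast
    then show "e \<in> ?e ` I"
      using j by blast
  qed
qed

section \<open>Completions\<close>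

lemma ideals_set_simps [simp]:
  "\<one>\<^bsub>ideals_set R\<^esub> = carrier R"
  "I \<otimes>\<^bsub>ideals_set R\<^esub> J = ideal_prod R I J"
  by (simp_all add: ideals_set_def)

context cring
begin

lemma ideal_ideal_power:
  assumes "ideal I R"
  shows "ideal (ideal_power R I n) R"
  by (induction n) (simp_all add: oneideal ideal_prod_is_ideal assms)

text \<open>Powers start from the zeroth one, the whole ring, so the first power is the product of
  the whole ring with \<open>I\<close>.\<close>

lemma ideal_power_1:
  assumes "ideal I R"
  shows "ideal_power R I (Suc 0) = I"
  by (simp add: ideal_prod_one ideal_prod_commute[OF oneideal] assms)

text \<open>A product of ideals lies in their intersection. Hence the cosets of one element at
  successive levels are nested.\<close>

lemma ideal_power_Suc_subset:
  assumes "ideal I R"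
  shows "ideal_power R I (Suc n) \<subseteq> ideal_power R I n"
  using ideal_prod_inter[OF ideal_ideal_power[OF assms] assms] by auto

lemma nat_pow_in_ideal_power:
  assumes "ideal I R" "a \<in> I"
  shows "a [^] n \<in> ideal_power R I n"
  by (induction n) (simp_all add: ideal_prod.prod assms)

end

lemma (in ideal) quot_ex_coset:
  assumes "C \<in> carrier (R Quot I)"
  shows "\<exists>a\<in>carrier R. C = I +> a"
  using assms by (auto simp: FactRing_simps)

lemma (in ideal) quot_eq_coset:
  assumes "C \<in> carrier (R Quot I)" "a \<in> C"
  shows "a \<in> carrier R" "C = I +> a"
proof -
  obtain x where x: "x \<in> carrier R" "C = I +> x"
    using assms quot_ex_coset by blast
  then show a: "a \<in> carrier R"
    using assms a_subset a_r_coset_subset_G by blast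
  show "C = I +> a"
    using a_repr_independence'[of a x] x assms by simp
qed

text \<open>The locale of maximal ideals contains the assumption that \<open>OK\<close> is a ring, so the existence of
  a maximal ideal replaces the proof that algebraic integers are closed under ring operations.
  Without maximal ideals, \<open>Ohat\<close> would be the trivial ring.\<close>

lemma OK_cring:
  fixes \<pp> :: "'k::number_field set"
  assumes "\<pp> \<in> maximal_ideals"
  shows "cring (OK :: 'k ring)"
proof -
  interpret maximalideal \<pp> "OK :: 'k ring"
    using assms by (simp add: maximal_ideals_def)
  show ?thesis
    by unfold_locales (simp add: int_ring_def ring_of_type_algebra_def)
qed

section \<open>The completion at one maximal ideal\<close>

context
  fixes \<pp> :: "'k::number_field set"
  assumes \<pp>: "\<pp> \<in> maximal_ideals"
begin

interpretation OK: cring "OK :: 'k ring"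
  by (rule OK_cring[OF \<pp>])

interpretation \<pp>: maximalideal \<pp> "OK :: 'k ring"
  using \<pp> by (simp add: maximal_ideals_def)

abbreviation (input) "coset n a \<equiv> ideal_power OK \<pp> n +>\<^bsub>OK\<^esub> a"

lemma ideal_ideal_power_OK: "ideal (ideal_power OK \<pp> n) OK"
  by (rule OK.ideal_ideal_power[OF \<pp>.is_ideal])

lemma residue_ring_pow_cring: "cring (residue_ring_pow \<pp> n)"
  unfolding residue_ring_pow_def
  by (rule ideal.quotient_is_cring[OF ideal_ideal_power_OK OK.is_cring])

lemma residue_ring_pow_zero: "\<zero>\<^bsub>residue_ring_pow \<pp> n\<^esub> = ideal_power OK \<pp> n"
  by (simp add: residue_ring_pow_def FactRing_def)

interpretation coset: ring_hom_ring OK "residue_ring_pow \<pp> n" "coset n" for n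
  unfolding residue_ring_pow_def by (rule ideal.rcos_ring_hom_ring[OF ideal_ideal_power_OK])

lemma mem_coset:
  assumes "a \<in> carrier OK"
  shows "a \<in> coset n a"
proof -
  interpret I: ideal "ideal_power OK \<pp> n" OK
    by (rule ideal_ideal_power_OK)
  show ?thesis
    using assms by (rule I.a_rcos_self)
qed

text \<open>Nested consecutive cosets have a common representative, since any representative of the
  smaller one lies in the larger one. In this form, closure under the ring operations reduces to the
  coset maps being homomorphisms.\<close>

lemma Op_carrier_iff:
  "x \<in> carrier (Op \<pp>) \<longleftrightarrow>
    (\<forall>n. \<exists>a\<in>carrier OK. x (Suc n) = coset (Suc n) a \<and> x n = coset n a)"
proof safe
  fix n assume x: "x \<in> carrier (Op \<pp>)"
  then have *: "x (Suc n) \<in> carrier (residue_ring_pow \<pp> (Suc n))"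
      "x n \<in> carrier (residue_ring_pow \<pp> n)" "x (Suc n) \<subseteq> x n"
    by (auto simp: Op_def)
  obtain a where a: "a \<in> carrier OK" "x (Suc n) = coset (Suc n) a"
    using ideal.quot_ex_coset[OF ideal_ideal_power_OK *(1)[unfolded residue_ring_pow_def]] by blast
  then have "a \<in> x n"
    using mem_coset *(3) by blast
  then have "x n = coset n a"
    using ideal.quot_eq_coset(2)[OF ideal_ideal_power_OK *(2)[unfolded residue_ring_pow_def]] by blast
  then show "\<exists>a\<in>carrier OK. x (Suc n) = coset (Suc n) a \<and> x n = coset n a"
    using a by blast
next
  assume x: "\<forall>n. \<exists>a\<in>carrier OK. x (Suc n) = coset (Suc n) a \<and> x n = coset n a"
  have "x n \<in> carrier (residue_ring_pow \<pp> n)" for n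
    using x coset.hom_closed by metis
  moreover have "x (Suc n) \<subseteq> x n" for n
  proof -
    obtain a where "x (Suc n) = coset (Suc n) a" "x n = coset n a"
      using x by blast
    then show ?thesis
      using OK.ideal_power_Suc_subset[OF \<pp>.is_ideal, of n] by (auto simp: a_r_coset_def r_coset_def)
  qed
  ultimately show "x \<in> carrier (Op \<pp>)"
    by (simp add: Op_def)
qed

text \<open>The inverse limit is a subring of the product of all residue rings: representatives
  common to two consecutive levels can be negated, multiplied and added.\<close>

lemma Op_cring: "cring (Op \<pp>)"
proof -
  let ?P = "ring_prod UNIV (residue_ring_pow \<pp>)"
  interpret P: cring ?P
    by (rule ring_prod_cring[OF residue_ring_pow_cring])
  have Op: "Op \<pp> = ?P\<lparr>carrier := carrier (Op \<pp>)\<rparr>"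
    by (simp add: Op_def)
  have sub: "carrier (Op \<pp>) \<subseteq> carrier ?P"
    by (auto simp: Op_def ring_prod_simps)
  have "subring (carrier (Op \<pp>)) ?P"
  proof (rule P.subringI[OF sub])
    show "\<one>\<^bsub>?P\<^esub> \<in> carrier (Op \<pp>)"
      using coset.hom_one by (auto simp: Op_carrier_iff ring_prod_simps simp del: nat_pow_Suc
          intro!: bexI[of _ "\<one>\<^bsub>OK\<^esub>"])
    fix x assume x: "x \<in> carrier (Op \<pp>)"
    have "(\<lambda>n. \<ominus>\<^bsub>residue_ring_pow \<pp> n\<^esub> x n) \<in> carrier (Op \<pp>)"
      unfolding Op_carrier_iff
    proof
      fix n
      obtain a where a: "a \<in> carrier OK" "x (Suc n) = coset (Suc n) a" "x n = coset n a"
        using x unfolding Op_carrier_iff by blast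
      then show "\<exists>a\<in>carrier OK. \<ominus>\<^bsub>residue_ring_pow \<pp> (Suc n)\<^esub> x (Suc n) = coset (Suc n) a \<and>
          \<ominus>\<^bsub>residue_ring_pow \<pp> n\<^esub> x n = coset n a"
        by (intro bexI[of _ "\<ominus>\<^bsub>OK\<^esub> a"]) (simp_all add: coset.hom_a_inv del: nat_pow_Suc)
    qed
    \<comment> \<open>Negation in the product is not given by a formula, so it is identified through
      uniqueness of additive inverses.\<close>
    moreover have "\<ominus>\<^bsub>?P\<^esub> x = (\<lambda>n. \<ominus>\<^bsub>residue_ring_pow \<pp> n\<^esub> x n)"
      using x sub calculation
      by (intro P.minus_equality)
        (auto simp: ring_prod_simps cring.cring_simprules[OF residue_ring_pow_cring] Op_def)
    ultimately show "\<ominus>\<^bsub>?P\<^esub> x \<in> carrier (Op \<pp>)"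
      by simp
    fix y assume y: "y \<in> carrier (Op \<pp>)"
    show "x \<otimes>\<^bsub>?P\<^esub> y \<in> carrier (Op \<pp>)"
      unfolding Op_carrier_iff
    proof
      fix n
      obtain a b where "a \<in> carrier OK" "x (Suc n) = coset (Suc n) a" "x n = coset n a"
        "b \<in> carrier OK" "y (Suc n) = coset (Suc n) b" "y n = coset n b"
        using x y unfolding Op_carrier_iff by metis
      then show "\<exists>a\<in>carrier OK. (x \<otimes>\<^bsub>?P\<^esub> y) (Suc n) = coset (Suc n) a \<and> (x \<otimes>\<^bsub>?P\<^esub> y) n = coset n a"
        by (intro bexI[of _ "a \<otimes>\<^bsub>OK\<^esub> b"]) (simp_all add: ring_prod_simps coset.hom_mult del: nat_pow_Suc)
    qed
    show "x \<oplus>\<^bsub>?P\<^esub> y \<in> carrier (Op \<pp>)"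
      unfolding Op_carrier_iff
    proof
      fix n
      obtain a b where "a \<in> carrier OK" "x (Suc n) = coset (Suc n) a" "x n = coset n a"
        "b \<in> carrier OK" "y (Suc n) = coset (Suc n) b" "y n = coset n b"
        using x y unfolding Op_carrier_iff by metis
      then show "\<exists>a\<in>carrier OK. (x \<oplus>\<^bsub>?P\<^esub> y) (Suc n) = coset (Suc n) a \<and> (x \<oplus>\<^bsub>?P\<^esub> y) n = coset n a"
        by (intro bexI[of _ "a \<oplus>\<^bsub>OK\<^esub> b"]) (simp_all add: ring_prod_simps coset.hom_add del: nat_pow_Suc)
    qed
  qed
  then have "subcring (carrier (Op \<pp>)) ?P"
    by (rule P.subcringI')
  then show ?thesis
    using P.subcring_iff[OF sub] Op by simp
qed

lemma Op_simps:
  "x \<otimes>\<^bsub>Op \<pp>\<^esub> y = (\<lambda>n. x n \<otimes>\<^bsub>residue_ring_pow \<pp> n\<^esub> y n)"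
  "\<one>\<^bsub>Op \<pp>\<^esub> = (\<lambda>n. \<one>\<^bsub>residue_ring_pow \<pp> n\<^esub>)"
  "\<zero>\<^bsub>Op \<pp>\<^esub> = (\<lambda>n. \<zero>\<^bsub>residue_ring_pow \<pp> n\<^esub>)"
  "x \<oplus>\<^bsub>Op \<pp>\<^esub> y = (\<lambda>n. x n \<oplus>\<^bsub>residue_ring_pow \<pp> n\<^esub> y n)"
  by (simp_all add: Op_def ring_prod_def restrict_UNIV)

lemma residue_field: "field (residue_ring_pow \<pp> (Suc 0))"
  unfolding residue_ring_pow_def OK.ideal_power_1[OF \<pp>.is_ideal]
  by (rule \<pp>.quotient_is_field[OF OK.is_cring])

text \<open>Level zero is the trivial ring, so the comparison is made at level one, the residue
  field.\<close>

lemma Op_one_neq_zero: "\<one>\<^bsub>Op \<pp>\<^esub> \<noteq> \<zero>\<^bsub>Op \<pp>\<^esub>"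
proof
  interpret k: field "residue_ring_pow \<pp> (Suc 0)" by (rule residue_field)
  assume "\<one>\<^bsub>Op \<pp>\<^esub> = \<zero>\<^bsub>Op \<pp>\<^esub>"
  then have "\<one>\<^bsub>residue_ring_pow \<pp> (Suc 0)\<^esub> = \<zero>\<^bsub>residue_ring_pow \<pp> (Suc 0)\<^esub>"
    unfolding Op_simps by (rule fun_cong)
  then show False
    by simp
qed

text \<open>An element \<open>a\<close> of \<open>\<pp>\<close> that is idempotent modulo \<open>\<pp>\<^sup>n\<close> is congruent to \<open>a\<^sup>n \<in> \<pp>\<^sup>n\<close>.\<close>

lemma Op_idempotent_eq_zero:
  assumes "e \<in> idempotents (Op \<pp>)" "e (Suc 0) = \<zero>\<^bsub>residue_ring_pow \<pp> (Suc 0)\<^esub>"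
  shows "e = \<zero>\<^bsub>Op \<pp>\<^esub>"
proof
  fix n
  let ?Q = "residue_ring_pow \<pp> n"
  interpret Q: cring ?Q by (rule residue_ring_pow_cring)
  have e: "e \<in> carrier (Op \<pp>)" "e \<otimes>\<^bsub>Op \<pp>\<^esub> e = e"
    using assms(1) by (auto simp: idempotents_def)
  then have e_n: "e n \<otimes>\<^bsub>?Q\<^esub> e n = e n"
    by (metis Op_simps(1))
  obtain a where a: "a \<in> carrier OK" "e n = coset n a"
    using e(1) unfolding Op_carrier_iff by blast
  have "e n = \<zero>\<^bsub>?Q\<^esub>"
  proof (cases n)
    \<comment> \<open>Modulo the zeroth power, which is the whole ring, every element is
      zero.\<close>
    case 0
    have "coset n a = coset n \<zero>\<^bsub>OK\<^esub>"
      using a 0 OK.quotient_eq_iff_same_a_r_cos[OF ideal_ideal_power_OK[of n], of a "\<zero>\<^bsub>OK\<^esub>"]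
      by simp
    then show ?thesis
      using a coset.hom_zero[of n] by simp
  next
    case (Suc m)
    \<comment> \<open>The cosets shrink as the level grows, and by assumption the one at level one
      is \<open>\<pp>\<close> itself.\<close>
    have "e (Suc k) \<subseteq> \<pp>" for k
    proof (induction k)
      case 0
      then show ?case
        using assms(2) unfolding residue_ring_pow_zero OK.ideal_power_1[OF \<pp>.is_ideal] by simp
    next
      case (Suc k)
      then show ?case
        using e(1) by (auto simp: Op_def)
    qed
    then have "a \<in> \<pp>"
      using a mem_coset Suc by blast
    have "e n \<in> carrier ?Q"
      using a coset.hom_closed by simp
    \<comment> \<open>Only positive exponents are taken: the zeroth power is one, not
      \<open>e n\<close>. The case \<open>n = Suc m\<close> provides such an exponent.\<close>
    then have "e n [^]\<^bsub>?Q\<^esub> Suc k = e n" for k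
      using e_n by (induction k) simp_all
    then have "e n = e n [^]\<^bsub>?Q\<^esub> n"
      unfolding Suc by (rule sym)
    also have "\<dots> = coset n (a [^]\<^bsub>OK\<^esub> n)"
      unfolding a(2) by (rule coset.hom_nat_pow[OF a(1), symmetric])
    also have "\<dots> = \<zero>\<^bsub>?Q\<^esub>"
    proof -
      have "a [^]\<^bsub>OK\<^esub> n \<in> ideal_power OK \<pp> n"
        by (rule OK.nat_pow_in_ideal_power[OF \<pp>.is_ideal \<open>a \<in> \<pp>\<close>])
      then show ?thesis
        unfolding residue_ring_pow_zero by (rule OK.a_rcos_zero[OF ideal_ideal_power_OK])
    qed
    finally show ?thesis .
  qed
  then show "e n = \<zero>\<^bsub>Op \<pp>\<^esub> n"
    by (simp add: Op_simps)
qed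

text \<open>For \<open>f = 1 - e\<close> the product \<open>e f\<close> vanishes, so
  \<open>e\<close> or \<open>f\<close> is zero in the residue field at level one. Both are
  idempotent, so the one that vanishes there vanishes at all levels.\<close>

lemma Op_idempotents:
  assumes "e \<in> idempotents (Op \<pp>)"
  shows "e = \<zero>\<^bsub>Op \<pp>\<^esub> \<or> e = \<one>\<^bsub>Op \<pp>\<^esub>"
proof -
  interpret O: cring "Op \<pp>" by (rule Op_cring)
  interpret k: field "residue_ring_pow \<pp> (Suc 0)" by (rule residue_field)
  have e: "e \<in> carrier (Op \<pp>)" "e \<otimes>\<^bsub>Op \<pp>\<^esub> e = e"
    using assms by (auto simp: idempotents_def)
  define f where "f = \<one>\<^bsub>Op \<pp>\<^esub> \<ominus>\<^bsub>Op \<pp>\<^esub> e"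
  have f: "f \<in> carrier (Op \<pp>)" "f \<oplus>\<^bsub>Op \<pp>\<^esub> e = \<one>\<^bsub>Op \<pp>\<^esub>" "e \<otimes>\<^bsub>Op \<pp>\<^esub> f = \<zero>\<^bsub>Op \<pp>\<^esub>"
    using e unfolding f_def by (simp_all add: O.minus_eq O.r_distr O.r_minus O.r_neg O.l_neg O.a_assoc)
  have "f = (f \<oplus>\<^bsub>Op \<pp>\<^esub> e) \<otimes>\<^bsub>Op \<pp>\<^esub> f"
    using f(1,2) by simp
  also have "\<dots> = f \<otimes>\<^bsub>Op \<pp>\<^esub> f"
    using e(1) f(1,3) by (simp add: O.l_distr)
  finally have "f \<otimes>\<^bsub>Op \<pp>\<^esub> f = f"
    by (rule sym)
  then have f_idem: "f \<in> idempotents (Op \<pp>)"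
    using f by (simp add: idempotents_def)
  have "e (Suc 0) \<otimes>\<^bsub>residue_ring_pow \<pp> (Suc 0)\<^esub> f (Suc 0) = \<zero>\<^bsub>residue_ring_pow \<pp> (Suc 0)\<^esub>"
    using fun_cong[OF f(3), of "Suc 0"] by (simp add: Op_simps)
  moreover have "e (Suc 0) \<in> carrier (residue_ring_pow \<pp> (Suc 0))"
    "f (Suc 0) \<in> carrier (residue_ring_pow \<pp> (Suc 0))"
    using e(1) f(1) by (auto simp: Op_def)
  ultimately have "e (Suc 0) = \<zero>\<^bsub>residue_ring_pow \<pp> (Suc 0)\<^esub> \<or>
      f (Suc 0) = \<zero>\<^bsub>residue_ring_pow \<pp> (Suc 0)\<^esub>"
    using k.integral by blast
  then have "e = \<zero>\<^bsub>Op \<pp>\<^esub> \<or> f = \<zero>\<^bsub>Op \<pp>\<^esub>"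
    using Op_idempotent_eq_zero assms f_idem by blast
  then show ?thesis
    using e(1) O.r_right_minus_eq unfolding f_def by auto
qed

end

section \<open>The profinite completion\<close>

lemma Ohat_cring: "cring Ohat"
  unfolding Ohat_def by (rule ring_prod_cring[OF Op_cring])

lemma bij_betw_maximal_idempotents_Ohat:
  "bij_betw (\<lambda>\<pp>. \<lambda>\<qq>\<in>maximal_ideals. if \<qq> = \<pp> then \<zero>\<^bsub>Op \<qq>\<^esub> else \<one>\<^bsub>Op \<qq>\<^esub>)
    maximal_ideals (maximal_idempotents Ohat)"
  unfolding Ohat_def
  by (rule bij_betw_maximal_idempotents_ring_prod[OF Op_cring Op_one_neq_zero Op_idempotents])

section \<open>Integral adeles\<close>

context cring
begin

lemma nonzerodivisors_one: "\<one> \<in> nonzerodivisors R"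
  by (simp add: nonzerodivisors_def)

lemma nonzerodivisors_closed: "s \<in> nonzerodivisors R \<Longrightarrow> s \<in> carrier R"
  by (simp add: nonzerodivisors_def)

lemma nonzerodivisors_cancel:
  assumes "s \<in> nonzerodivisors R" "a \<in> carrier R" "b \<in> carrier R" "s \<otimes> a = s \<otimes> b"
  shows "a = b"
proof -
  have s: "s \<in> carrier R"
    using assms(1) by (rule nonzerodivisors_closed)
  have "s \<otimes> (a \<ominus> b) = \<zero>"
    using assms s by (simp add: minus_eq r_distr r_minus r_neg)
  then have "a \<ominus> b = \<zero>"
    using assms by (simp add: nonzerodivisors_def)
  then show ?thesis
    using assms by (simp add: r_right_minus_eq)
qed

lemma nonzerodivisors_mult:
  assumes "s \<in> nonzerodivisors R" "t \<in> nonzerodivisors R"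
  shows "s \<otimes> t \<in> nonzerodivisors R"
  unfolding nonzerodivisors_def
proof (clarify, intro conjI ballI impI)
  note s = assms(1)[THEN nonzerodivisors_closed] and t = assms(2)[THEN nonzerodivisors_closed]
  show "s \<otimes> t \<in> carrier R"
    using s t by simp
  fix a assume a: "a \<in> carrier R" "(s \<otimes> t) \<otimes> a = \<zero>"
  then have "s \<otimes> (t \<otimes> a) = \<zero>"
    using s t by (simp add: m_assoc)
  then have "t \<otimes> a = \<zero>"
    using assms(1) a(1) t by (simp add: nonzerodivisors_def)
  then show "a = \<zero>"
    using assms(2) a(1) by (simp add: nonzerodivisors_def)
qed

lemma equiv_frac_rel: "equiv (carrier R \<times> nonzerodivisors R) (frac_rel R)"
proof (rule equivI)
  show "frac_rel R \<subseteq> (carrier R \<times> nonzerodivisors R) \<times> (carrier R \<times> nonzerodivisors R)"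
    by (auto simp: frac_rel_def)
  show "refl_on (carrier R \<times> nonzerodivisors R) (frac_rel R)"
    by (auto simp: refl_on_def frac_rel_def)
  show "sym (frac_rel R)"
    by (auto simp: sym_def frac_rel_def)
  show "trans (frac_rel R)"
  proof (rule transI, clarify)
    fix a s b t c u
    assume "((a, s), (b, t)) \<in> frac_rel R" "((b, t), (c, u)) \<in> frac_rel R"
    then have mem: "a \<in> carrier R" "b \<in> carrier R" "c \<in> carrier R"
        "s \<in> nonzerodivisors R" "t \<in> nonzerodivisors R" "u \<in> nonzerodivisors R"
      and eq: "a \<otimes> t = b \<otimes> s" "b \<otimes> u = c \<otimes> t"
      by (auto simp: frac_rel_def)
    note [simp] = nonzerodivisors_closed[OF mem(4)] nonzerodivisors_closed[OF mem(5)]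
      nonzerodivisors_closed[OF mem(6)] mem(1-3)
    \<comment> \<open>The cross products agree after multiplication by the middle denominator
      \<open>t\<close>, which is then cancelled as a non zero divisor.\<close>
    have "t \<otimes> (a \<otimes> u) = (a \<otimes> t) \<otimes> u"
      by (simp add: m_ac)
    also have "\<dots> = (b \<otimes> u) \<otimes> s"
      unfolding eq(1) by (simp add: m_ac)
    also have "\<dots> = t \<otimes> (c \<otimes> s)"
      unfolding eq(2) by (simp add: m_ac)
    finally have "a \<otimes> u = c \<otimes> s"
      by (rule nonzerodivisors_cancel[OF mem(5), rotated 2]) simp_all
    then show "((a, s), (c, u)) \<in> frac_rel R"
      using mem by (simp add: frac_rel_def)
  qed
qed

text \<open>The multiplication of \<open>frac_ring\<close> is a union over all representatives. It
  collapses to a single class because the formula respects \<open>frac_rel\<close> in both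
  arguments; by commutativity it is enough to vary one of them.\<close>

lemma fraction_mult:
  assumes "a \<in> carrier R" "s \<in> nonzerodivisors R" "b \<in> carrier R" "t \<in> nonzerodivisors R"
  shows "fraction R a s \<otimes>\<^bsub>frac_ring R\<^esub> fraction R b t = fraction R (a \<otimes> b) (s \<otimes> t)"
proof -
  let ?A = "carrier R \<times> nonzerodivisors R"
  have "(\<lambda>x y. fraction R (fst x \<otimes> fst y) (snd x \<otimes> snd y)) respects2 frac_rel R"
  proof (rule congruent2_commuteI[OF equiv_frac_rel])
    show "fraction R (fst x \<otimes> fst y) (snd x \<otimes> snd y) = fraction R (fst y \<otimes> fst x) (snd y \<otimes> snd x)"
      if "x \<in> ?A" "y \<in> ?A" for x y
      using that by (auto simp: m_comm nonzerodivisors_closed)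
    fix x y z assume x: "x \<in> ?A" and yz: "(y, z) \<in> frac_rel R"
    obtain c u where [simp]: "x = (c, u)" by (cases x)
    obtain d v where [simp]: "y = (d, v)" by (cases y)
    obtain e w where [simp]: "z = (e, w)" by (cases z)
    have mem: "c \<in> carrier R" "d \<in> carrier R" "e \<in> carrier R"
        "u \<in> nonzerodivisors R" "v \<in> nonzerodivisors R" "w \<in> nonzerodivisors R"
      and eq: "d \<otimes> w = e \<otimes> v"
      using x yz by (auto simp: frac_rel_def)
    note cl = mem(1-3) mem(4-6)[THEN nonzerodivisors_closed]
    have "(c \<otimes> d) \<otimes> (u \<otimes> w) = (c \<otimes> u) \<otimes> (d \<otimes> w)"
      using cl by (simp add: m_ac)
    also have "\<dots> = (c \<otimes> e) \<otimes> (u \<otimes> v)"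
      unfolding eq using cl by (simp add: m_ac)
    finally have "((c \<otimes> d, u \<otimes> v), (c \<otimes> e, u \<otimes> w)) \<in> frac_rel R"
      using mem by (simp add: frac_rel_def nonzerodivisors_mult)
    then show "fraction R (fst x \<otimes> fst y) (snd x \<otimes> snd y) = fraction R (fst x \<otimes> fst z) (snd x \<otimes> snd z)"
      unfolding fraction_def by (simp add: equiv_class_eq[OF equiv_frac_rel])
  qed
  note resp = this
  have "fraction R a s \<otimes>\<^bsub>frac_ring R\<^esub> fraction R b t =
      (\<Union>x\<in>frac_rel R `` {(a, s)}. \<Union>y\<in>frac_rel R `` {(b, t)}. fraction R (fst x \<otimes> fst y) (snd x \<otimes> snd y))"
    by (simp only: frac_ring_def monoid.simps fraction_def[of R a s] fraction_def[of R b t] case_prod_unfold)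
  also have "\<dots> = fraction R (fst (a, s) \<otimes> fst (b, t)) (snd (a, s) \<otimes> snd (b, t))"
    using assms by (subst UN_equiv_class2[OF equiv_frac_rel equiv_frac_rel resp]) simp_all
  finally show ?thesis
    by (simp only: fst_conv snd_conv)
qed

lemma fraction_in_carrier:
  assumes "a \<in> carrier R" "s \<in> nonzerodivisors R"
  shows "fraction R a s \<in> carrier (frac_ring R)"
  using assms by (auto simp: frac_ring_def fraction_def intro!: quotientI)

end

section \<open>The Galois group of the maximal abelian extension\<close>

text \<open>The automorphisms that fix \<open>F\<close> form a subgroup of the group of all
  bijections of \<open>E\<close>.\<close>

lemma group_galois_group:
  assumes E: "subfield E (ring_of_type_algebra :: 'a::field ring)" and "F \<subseteq> E"
  shows "group (galois_group F E)"
proof -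
  let ?A = "ring_of_type_algebra :: 'a ring"
  let ?E = "?A\<lparr>carrier := E\<rparr>"
  interpret A: ring ?A
    by (rule ring_from_type_algebra)
  interpret E: ring ?E
    using A.subring_is_ring subfieldE(1)[OF E] by blast
  let ?G = "carrier (galois_group F E)"
  have G: "\<sigma> \<in> ?G \<longleftrightarrow> \<sigma> \<in> Bij E \<and> \<sigma> \<in> ring_hom ?E ?E \<and> (\<forall>x\<in>F. \<sigma> x = x)" for \<sigma>
    by (simp add: galois_group_def)
  have "subgroup ?G (BijGroup E)"
  proof (rule group.subgroupI[OF group_BijGroup])
    show "?G \<subseteq> carrier (BijGroup E)"
      by (auto simp: G BijGroup_def)
    \<comment> \<open>Elements of \<open>BijGroup E\<close> are undefined outside \<open>E\<close>,
      so identity, inverse and composite appear as restrictions to \<open>E\<close>;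
      \<open>ring_hom_restrict\<close> carries the homomorphism property over to them.\<close>
    have "(\<lambda>x\<in>E. x) \<in> ring_hom ?E ?E"
      using E.ring_hom_restrict[of id ?E "\<lambda>x\<in>E. x"] id_ring_hom by simp
    then have "(\<lambda>x\<in>E. x) \<in> ?G"
      using \<open>F \<subseteq> E\<close> id_Bij by (auto simp: G)
    then show "?G \<noteq> {}" by blast
    fix \<sigma> assume "\<sigma> \<in> ?G"
    then have \<sigma>: "\<sigma> \<in> Bij E" "\<sigma> \<in> ring_hom ?E ?E" "\<forall>x\<in>F. \<sigma> x = x"
      by (auto simp: G)
    then have "\<sigma> \<in> ring_iso ?E ?E"
      by (simp add: ring_iso_def Bij_def)
    then have "inv_into E \<sigma> \<in> ring_hom ?E ?E"
      using ring_iso_set_sym[OF E.ring_axioms] by (fastforce simp: ring_iso_def)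
    then have "(\<lambda>x\<in>E. inv_into E \<sigma> x) \<in> ring_hom ?E ?E"
      by (rule E.ring_hom_restrict) simp
    moreover have "inv_into E \<sigma> x = x" if "x \<in> F" for x
      using that \<sigma> \<open>F \<subseteq> E\<close> by (metis Bij_def IntD2 bij_betw_imp_inj_on inv_into_f_f mem_Collect_eq subsetD)
    ultimately show "inv\<^bsub>BijGroup E\<^esub> \<sigma> \<in> ?G"
      using \<sigma> \<open>F \<subseteq> E\<close> by (auto simp: G inv_BijGroup restrict_inv_into_Bij)
    fix \<tau> assume "\<tau> \<in> ?G"
    then have \<tau>: "\<tau> \<in> Bij E" "\<tau> \<in> ring_hom ?E ?E" "\<forall>x\<in>F. \<tau> x = x"
      by (auto simp: G)
    have "compose E \<sigma> \<tau> \<in> ring_hom ?E ?E"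
      using ring_hom_trans[OF \<tau>(2) \<sigma>(2)] by (rule E.ring_hom_restrict) (simp add: compose_def)
    then show "\<sigma> \<otimes>\<^bsub>BijGroup E\<^esub> \<tau> \<in> ?G"
      using \<sigma> \<tau> \<open>F \<subseteq> E\<close> compose_Bij by (auto simp: G BijGroup_def compose_def)
  qed
  then show ?thesis
    using subgroup.subgroup_is_group[OF _ group_BijGroup] by (simp add: galois_group_def BijGroup_def)
qed

lemma subfield_base_field: "subfield (base_field :: 'k::number_field alg_closure set) ring_of_type_algebra"
proof -
  let ?K = "ring_of_type_algebra :: 'k ring" and ?L = "ring_of_type_algebra :: 'k alg_closure ring"
  interpret K: field ?K by (rule field_from_type_algebra)
  interpret h: ring_hom_ring ?K ?L to_ac
    by (rule ring_hom_ringI2[OF ring_from_type_algebra ring_from_type_algebra])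
      (auto intro!: ring_hom_memI simp: ring_of_type_algebra_def)
  have "subfield (carrier ?K) ?K"
    by (rule K.carrier_is_subfield)
  then have "subfield (to_ac ` carrier ?K) ?L"
    by (rule h.img_is_subfield(2)) (simp add: ring_of_type_algebra_def)
  then show ?thesis
    by (simp add: ring_of_type_algebra_def)
qed

text \<open>This is the trivial extension, of dimension one, whose only automorphism is the
  identity. It serves to place \<open>base_field\<close> inside \<open>Kab\<close>, so that
  \<open>Gab\<close> is seen to be a group.\<close>

lemma finite_abelian_extension_base_field:
  "finite_abelian_extension (base_field :: 'k::number_field alg_closure set)"
proof -
  let ?F = "base_field :: 'k alg_closure set"
  let ?G = "galois_group ?F ?F"
  interpret A: field "ring_of_type_algebra :: 'k alg_closure ring"
    by (rule field_from_type_algebra)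
  interpret G: group ?G
    by (rule group_galois_group[OF subfield_base_field subset_refl])
  have G: "\<sigma> = (\<lambda>x\<in>?F. x)" if "\<sigma> \<in> carrier ?G" for \<sigma>
    using that by (intro extensionalityI[of _ ?F]) (auto simp: galois_group_def Bij_def)
  have "comm_group ?G"
    by (rule G.group_comm_groupI) (metis G)
  moreover have "{x \<in> ?F. \<forall>\<sigma>\<in>carrier ?G. \<sigma> x = x} = ?F"
    by (auto simp: galois_group_def)
  moreover have "A.finite_dimension ?F ?F"
    using A.dimension_one[OF subfield_base_field] unfolding A.finite_dimension_def by blast
  ultimately show ?thesis
    using subfield_base_field by (simp add: finite_abelian_extension_def)
qed

lemma group_Gab: "group (Gab :: 'k::number_field gal_elt monoid)"
proof -
  interpret A: field "ring_of_type_algebra :: 'k alg_closure ring"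
    by (rule field_from_type_algebra)
  have "subfield (Kab :: 'k alg_closure set) ring_of_type_algebra"
    unfolding Kab_def by (rule A.generate_field_is_subfield) (simp add: ring_of_type_algebra_def)
  moreover have "(base_field :: 'k alg_closure set) \<subseteq> Kab"
    using finite_abelian_extension_base_field unfolding Kab_def
    by (intro subsetI generate_field.incl) blast
  ultimately show ?thesis
    unfolding Gab_def by (rule group_galois_group)
qed

section \<open>Units of the integral adeles as ideles\<close>

lemma Op_to_Kp_carrier:
  assumes "\<pp> \<in> maximal_ideals" "a \<in> carrier (Op \<pp>)"
  shows "Op_to_Kp \<pp> a \<in> carrier (Kp \<pp>)"
  unfolding Op_to_Kp_def Kp_def
  using cring.fraction_in_carrier[OF Op_cring] cring.nonzerodivisors_one[OF Op_cring] assms by blast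

lemma Op_to_Kp_one: "Op_to_Kp \<pp> \<one>\<^bsub>Op \<pp>\<^esub> = \<one>\<^bsub>Kp \<pp>\<^esub>"
  by (simp add: Op_to_Kp_def Kp_def frac_ring_def)

lemma Op_to_Kp_mult:
  assumes "\<pp> \<in> maximal_ideals" "a \<in> carrier (Op \<pp>)" "b \<in> carrier (Op \<pp>)"
  shows "Op_to_Kp \<pp> (a \<otimes>\<^bsub>Op \<pp>\<^esub> b) = Op_to_Kp \<pp> a \<otimes>\<^bsub>Kp \<pp>\<^esub> Op_to_Kp \<pp> b"
proof -
  interpret O: cring "Op \<pp>" by (rule Op_cring[OF assms(1)])
  show ?thesis
    using O.fraction_mult[OF assms(2) O.nonzerodivisors_one assms(3) O.nonzerodivisors_one]
    by (simp add: Op_to_Kp_def Kp_def)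
qed

lemma finite_adeles_simps:
  "x \<otimes>\<^bsub>finite_adeles\<^esub> y = (\<lambda>\<pp>\<in>maximal_ideals. x \<pp> \<otimes>\<^bsub>Kp \<pp>\<^esub> y \<pp>)"
  "\<one>\<^bsub>finite_adeles\<^esub> = (\<lambda>\<pp>\<in>maximal_ideals. \<one>\<^bsub>Kp \<pp>\<^esub>)"
  by (simp_all add: finite_adeles_def ring_prod_simps)

lemma Ohat_to_adeles_hom: "Ohat_to_adeles \<in> hom Ohat finite_adeles"
proof (rule homI)
  have mem: "x \<pp> \<in> carrier (Op \<pp>)"
    if "x \<in> carrier Ohat" "\<pp> \<in> maximal_ideals" for x and \<pp> :: "'a set"
    using that by (auto simp: Ohat_def ring_prod_simps)
  fix x :: "'a set \<Rightarrow> nat \<Rightarrow> 'a set" assume x: "x \<in> carrier Ohat"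
  \<comment> \<open>An integral family has no exceptional places, so the finiteness condition in
    \<open>finite_adeles\<close> holds.\<close>
  have integral: "{\<pp> \<in> maximal_ideals. Ohat_to_adeles x \<pp> \<notin> Op_to_Kp \<pp> ` carrier (Op \<pp>)} = {}"
    using mem[OF x] by (auto simp: Ohat_to_adeles_def)
  show "Ohat_to_adeles x \<in> carrier finite_adeles"
    using mem[OF x] Op_to_Kp_carrier unfolding finite_adeles_def
    by (simp add: integral) (auto simp: Ohat_to_adeles_def)
  fix y :: "'a set \<Rightarrow> nat \<Rightarrow> 'a set" assume y: "y \<in> carrier Ohat"
  show "Ohat_to_adeles (x \<otimes>\<^bsub>Ohat\<^esub> y) = Ohat_to_adeles x \<otimes>\<^bsub>finite_adeles\<^esub> Ohat_to_adeles y"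
    unfolding finite_adeles_simps Ohat_to_adeles_def
    by (rule restrict_ext) (simp add: Ohat_def ring_prod_simps Op_to_Kp_mult
        mem[OF x, unfolded Ohat_def] mem[OF y, unfolded Ohat_def])
qed

lemma Ohat_to_adeles_one: "Ohat_to_adeles \<one>\<^bsub>Ohat\<^esub> = \<one>\<^bsub>finite_adeles\<^esub>"
  by (auto simp: Ohat_to_adeles_def finite_adeles_simps Ohat_def ring_prod_simps Op_to_Kp_one
      intro!: restrict_ext)

text \<open>The conjugate of an embedding is again an embedding, so the family of ones takes the
  value one there too, rather than being undefined.\<close>

lemma K_infinity_one_closed: "\<one>\<^bsub>K_infinity\<^esub> \<in> carrier K_infinity"
proof -
  have "(\<lambda>a. cnj (\<sigma> a)) \<in> embeddings" if "\<sigma> \<in> embeddings" for \<sigma> :: "'a \<Rightarrow> complex"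
    using that unfolding embeddings_def
    by (auto simp: ring_hom_def ring_of_type_algebra_def)
  then show ?thesis
    by (auto simp: K_infinity_def ring_prod_simps ring_of_type_algebra_def)
qed

lemma K_infinity_one_mult_one: "\<one>\<^bsub>K_infinity\<^esub> \<otimes>\<^bsub>K_infinity\<^esub> \<one>\<^bsub>K_infinity\<^esub> = \<one>\<^bsub>K_infinity\<^esub>"
  by (auto simp: K_infinity_def ring_prod_simps ring_of_type_algebra_def intro!: restrict_ext)

lemma RDirProd_simps:
  "(x, y) \<otimes>\<^bsub>RDirProd R S\<^esub> (x', y') = (x \<otimes>\<^bsub>R\<^esub> x', y \<otimes>\<^bsub>S\<^esub> y')"
  "\<one>\<^bsub>RDirProd R S\<^esub> = (\<one>\<^bsub>R\<^esub>, \<one>\<^bsub>S\<^esub>)"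
  by (simp_all add: RDirProd_def monoid.defs DirProd_def)

text \<open>This is \<open>artin\<close> composed with the inclusion of the units of
  \<open>Ohat\<close> into the ideles with archimedean component one. The image of a unit is an
  idele because the image of the inverse unit is its inverse.\<close>

lemma finite_rec_hom:
  fixes artin :: "'k::number_field idele \<Rightarrow> 'k gal_elt"
  assumes "artin \<in> hom ideles Gab"
  shows "(\<lambda>u. finite_rec artin (Ohat_to_adeles u)) \<in> hom (units_of Ohat) Gab"
proof -
  interpret O: cring "Ohat :: ('k set \<Rightarrow> nat \<Rightarrow> 'k set) ring" by (rule Ohat_cring)
  have "(\<lambda>u :: 'k set \<Rightarrow> nat \<Rightarrow> 'k set. (Ohat_to_adeles u, \<one>\<^bsub>K_infinity\<^esub>)) \<in> hom (units_of Ohat) ideles"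
  proof (rule homI)
    fix u :: "'k set \<Rightarrow> nat \<Rightarrow> 'k set" assume "u \<in> carrier (units_of Ohat)"
    then have u: "u \<in> Units Ohat"
      by (simp add: units_of_carrier)
    have "Ohat_to_adeles u \<otimes>\<^bsub>finite_adeles\<^esub> Ohat_to_adeles (inv\<^bsub>Ohat\<^esub> u) = \<one>\<^bsub>finite_adeles\<^esub>"
      "Ohat_to_adeles (inv\<^bsub>Ohat\<^esub> u) \<otimes>\<^bsub>finite_adeles\<^esub> Ohat_to_adeles u = \<one>\<^bsub>finite_adeles\<^esub>"
      using u hom_mult[OF Ohat_to_adeles_hom, of u "inv\<^bsub>Ohat\<^esub> u"]
        hom_mult[OF Ohat_to_adeles_hom, of "inv\<^bsub>Ohat\<^esub> u" u]
      by (simp_all add: Ohat_to_adeles_one O.Units_closed)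
    moreover have "Ohat_to_adeles u \<in> carrier finite_adeles"
      "Ohat_to_adeles (inv\<^bsub>Ohat\<^esub> u) \<in> carrier finite_adeles"
      using u by (simp_all add: O.Units_closed hom_in_carrier[OF Ohat_to_adeles_hom])
    ultimately show "(Ohat_to_adeles u, \<one>\<^bsub>K_infinity\<^esub>) \<in> carrier ideles"
      using K_infinity_one_closed K_infinity_one_mult_one
      unfolding ideles_def units_of_carrier Units_def RDirProd_carrier
      by (auto simp: RDirProd_simps
          intro!: bexI[of _ "(Ohat_to_adeles (inv\<^bsub>Ohat\<^esub> u), \<one>\<^bsub>K_infinity\<^esub>)"])
    fix v :: "'k set \<Rightarrow> nat \<Rightarrow> 'k set" assume "v \<in> carrier (units_of Ohat)"
    then show "(Ohat_to_adeles (u \<otimes>\<^bsub>units_of Ohat\<^esub> v), \<one>\<^bsub>K_infinity\<^esub>) =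
        (Ohat_to_adeles u, \<one>\<^bsub>K_infinity\<^esub>) \<otimes>\<^bsub>ideles\<^esub> (Ohat_to_adeles v, \<one>\<^bsub>K_infinity\<^esub>)"
      using u by (simp add: ideles_def units_of_mult units_of_carrier RDirProd_simps K_infinity_one_mult_one
          hom_mult[OF Ohat_to_adeles_hom] O.Units_closed)
  qed
  then show ?thesis
    using hom_compose[OF _ assms] by (fastforce simp: finite_rec_def comp_def)
qed

section \<open>Idempotents of a balanced product\<close>

lemma maximal_idempotents_subset: "maximal_idempotents M \<subseteq> idempotents M"
  by (auto simp: maximal_idempotents_def)

text \<open>Abstract form of \<open>DR_rel\<close>: \<open>A\<close> stands for \<open>Ohat\<close>,
  \<open>G\<close> for \<open>Gab\<close> and \<open>\<phi>\<close> for the reciprocity map on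
  units.\<close>

definition balanced_rel ::
    "('a, 'm) monoid_scheme \<Rightarrow> ('b, 'n) monoid_scheme \<Rightarrow> ('a \<Rightarrow> 'b) \<Rightarrow> (('a \<times> 'b) \<times> ('a \<times> 'b)) set" where
  "balanced_rel A G \<phi> = {((\<rho>, s), (\<rho> \<otimes>\<^bsub>A\<^esub> u, inv\<^bsub>G\<^esub> (\<phi> u) \<otimes>\<^bsub>G\<^esub> s)) | \<rho> s u.
     \<rho> \<in> carrier A \<and> s \<in> carrier G \<and> u \<in> Units A}"

definition balanced_product ::
    "('a, 'm) monoid_scheme \<Rightarrow> ('b, 'n) monoid_scheme \<Rightarrow> ('a \<Rightarrow> 'b) \<Rightarrow> ('a \<times> 'b) set monoid" where
  "balanced_product A G \<phi> =
    \<lparr>carrier = carrier (A \<times>\<times> G) // balanced_rel A G \<phi>,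
     monoid.mult = (\<lambda>C D. \<Union>x\<in>C. \<Union>y\<in>D. balanced_rel A G \<phi> `` {x \<otimes>\<^bsub>A \<times>\<times> G\<^esub> y}),
     one = balanced_rel A G \<phi> `` {\<one>\<^bsub>A \<times>\<times> G\<^esub>}\<rparr>"

locale balanced = A: comm_monoid A + G: group G
  for A :: "('a, 'm) monoid_scheme" (structure) and G :: "('b, 'n) monoid_scheme" and \<phi> +
  assumes \<phi>_hom: "\<phi> \<in> hom (units_of A) G"
begin

declare A.Units_closed [simp]

abbreviation "rel \<equiv> balanced_rel A G \<phi>"
abbreviation "P \<equiv> balanced_product A G \<phi>"
abbreviation "cls x \<equiv> rel `` {x}"

sublocale \<phi>: group_hom "units_of A" G \<phi>
  using \<phi>_hom A.units_group G.is_group by (simp add: group_hom_def group_hom_axioms_def)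

lemma \<phi>_simps:
  assumes "u \<in> Units A"
  shows "\<phi> u \<in> carrier G" "v \<in> Units A \<Longrightarrow> \<phi> (u \<otimes> v) = \<phi> u \<otimes>\<^bsub>G\<^esub> \<phi> v" "\<phi> (inv u) = inv\<^bsub>G\<^esub> \<phi> u"
  using assms \<phi>.hom_closed[of u] \<phi>.hom_mult[of u v] \<phi>.hom_inv[of u]
  by (simp_all add: units_of_carrier units_of_mult A.units_of_inv)

lemma \<phi>_one: "\<phi> \<one> = \<one>\<^bsub>G\<^esub>"
  using \<phi>.hom_one by (simp add: units_of_one)

lemma relI:
  assumes "\<rho> \<in> carrier A" "s \<in> carrier G" "u \<in> Units A" "\<rho>' = \<rho> \<otimes> u" "s' = inv\<^bsub>G\<^esub> (\<phi> u) \<otimes>\<^bsub>G\<^esub> s"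
  shows "((\<rho>, s), (\<rho>', s')) \<in> rel"
  using assms by (auto simp: balanced_rel_def)

lemma relE:
  assumes "((\<rho>, s), (\<rho>', s')) \<in> rel"
  obtains u where "\<rho> \<in> carrier A" "s \<in> carrier G" "u \<in> Units A"
    "\<rho>' = \<rho> \<otimes> u" "s' = inv\<^bsub>G\<^esub> (\<phi> u) \<otimes>\<^bsub>G\<^esub> s"
  using assms by (auto simp: balanced_rel_def)

text \<open>The classes are the orbits of the group \<open>Units A\<close>, where \<open>u\<close>
  sends \<open>(\<rho>, s)\<close> to \<open>(\<rho> u, inv (\<phi> u) s)\<close>.\<close>

lemma equiv_rel: "equiv (carrier (A \<times>\<times> G)) rel"
proof (rule equivI)
  show "rel \<subseteq> carrier (A \<times>\<times> G) \<times> carrier (A \<times>\<times> G)"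
    by (auto simp: balanced_rel_def \<phi>_simps)
  show "refl_on (carrier (A \<times>\<times> G)) rel"
    by (auto simp: refl_on_def \<phi>_one intro!: relI[of _ _ \<one>])
  show "sym rel"
  proof (rule symI, clarify)
    fix \<rho> s \<rho>' s' assume "((\<rho>, s), (\<rho>', s')) \<in> rel"
    then obtain u where u: "\<rho> \<in> carrier A" "s \<in> carrier G" "u \<in> Units A"
        "\<rho>' = \<rho> \<otimes> u" "s' = inv\<^bsub>G\<^esub> (\<phi> u) \<otimes>\<^bsub>G\<^esub> s"
      by (rule relE)
    have "\<rho> = \<rho>' \<otimes> inv u"
      using u by (simp add: A.m_assoc)
    moreover have "s = inv\<^bsub>G\<^esub> (\<phi> (inv u)) \<otimes>\<^bsub>G\<^esub> s'"
      using u by (simp add: \<phi>_simps G.m_assoc[symmetric])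
    ultimately show "((\<rho>', s'), (\<rho>, s)) \<in> rel"
      using u by (intro relI[of _ _ "inv u"]) (simp_all add: \<phi>_simps)
  qed
  show "trans rel"
  proof (rule transI, clarify)
    fix \<rho> s \<rho>' s' \<rho>'' s'' assume "((\<rho>, s), (\<rho>', s')) \<in> rel" "((\<rho>', s'), (\<rho>'', s'')) \<in> rel"
    then obtain u v where "\<rho> \<in> carrier A" "s \<in> carrier G" "u \<in> Units A" "v \<in> Units A"
        "\<rho>' = \<rho> \<otimes> u" "s' = inv\<^bsub>G\<^esub> (\<phi> u) \<otimes>\<^bsub>G\<^esub> s" "\<rho>'' = \<rho>' \<otimes> v" "s'' = inv\<^bsub>G\<^esub> (\<phi> v) \<otimes>\<^bsub>G\<^esub> s'"
      by (elim relE) blast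
    \<comment> \<open>Units commute, so \<open>\<phi> (v u) = \<phi> u \<phi> v\<close>; its inverse
      has \<open>inv (\<phi> v)\<close> on the left, the order in which the two steps
      compose.\<close>
    then show "((\<rho>, s), (\<rho>'', s'')) \<in> rel"
      by (intro relI[of _ _ "v \<otimes> u"])
        (simp_all add: \<phi>_simps G.inv_mult_group G.m_assoc A.m_assoc A.m_comm[of v u])
  qed
qed

lemma cls_mem: "\<rho> \<in> carrier A \<Longrightarrow> s \<in> carrier G \<Longrightarrow> (\<rho>, s) \<in> cls (\<rho>, s)"
  using equiv_class_self[OF equiv_rel] by simp

lemma cls_eqI: "((\<rho>, s), (\<rho>', s')) \<in> rel \<Longrightarrow> cls (\<rho>, s) = cls (\<rho>', s')"
  by (rule equiv_class_eq[OF equiv_rel])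

lemma cls_in_carrier: "\<rho> \<in> carrier A \<Longrightarrow> s \<in> carrier G \<Longrightarrow> cls (\<rho>, s) \<in> carrier P"
  by (auto simp: balanced_product_def intro!: quotientI)

text \<open>Only the commuting elements of \<open>\<phi> ` Units A\<close> are multiplied here, so this holds even if \<open>G\<close>
  is not commutative and the multiplication of arbitrary classes is not well defined.\<close>

lemma cls_mult:
  assumes a: "a \<in> carrier A" and b: "b \<in> carrier A"
  shows "cls (a, \<one>\<^bsub>G\<^esub>) \<otimes>\<^bsub>P\<^esub> cls (b, \<one>\<^bsub>G\<^esub>) = cls (a \<otimes> b, \<one>\<^bsub>G\<^esub>)"
proof -
  have "cls (x \<otimes>\<^bsub>A \<times>\<times> G\<^esub> y) = cls (a \<otimes> b, \<one>\<^bsub>G\<^esub>)"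
    if x: "x \<in> cls (a, \<one>\<^bsub>G\<^esub>)" and y: "y \<in> cls (b, \<one>\<^bsub>G\<^esub>)" for x y
  proof -
    obtain u where u: "u \<in> Units A" "x = (a \<otimes> u, inv\<^bsub>G\<^esub> (\<phi> u) \<otimes>\<^bsub>G\<^esub> \<one>\<^bsub>G\<^esub>)"
      using x by (auto simp: balanced_rel_def)
    obtain v where v: "v \<in> Units A" "y = (b \<otimes> v, inv\<^bsub>G\<^esub> (\<phi> v) \<otimes>\<^bsub>G\<^esub> \<one>\<^bsub>G\<^esub>)"
      using y by (auto simp: balanced_rel_def)
    have "(a \<otimes> u) \<otimes> (b \<otimes> v) = (a \<otimes> b) \<otimes> (v \<otimes> u)"
      using a b u(1) v(1) by (simp add: A.m_ac A.Units_closed)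
    moreover have "inv\<^bsub>G\<^esub> (\<phi> u) \<otimes>\<^bsub>G\<^esub> inv\<^bsub>G\<^esub> (\<phi> v) = inv\<^bsub>G\<^esub> (\<phi> (v \<otimes> u))"
      using u(1) v(1) by (simp add: \<phi>_simps G.inv_mult_group)
    ultimately have "((a \<otimes> b, \<one>\<^bsub>G\<^esub>), x \<otimes>\<^bsub>A \<times>\<times> G\<^esub> y) \<in> rel"
      using a b u v by (auto intro!: relI[of _ _ "v \<otimes> u"] simp: \<phi>_simps)
    then show ?thesis
      by (rule equiv_class_eq[OF equiv_rel, symmetric])
  qed
  \<comment> \<open>The product is a union of classes that are all equal; nonempty index sets make
    it that common class instead of the empty set.\<close>
  moreover have "cls (a, \<one>\<^bsub>G\<^esub>) \<noteq> {}" "cls (b, \<one>\<^bsub>G\<^esub>) \<noteq> {}"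
    using cls_mem[of _ "\<one>\<^bsub>G\<^esub>"] a b by blast+
  ultimately show ?thesis
    by (simp add: balanced_product_def)
qed

lemma cls_one: "cls (\<one>, \<one>\<^bsub>G\<^esub>) = \<one>\<^bsub>P\<^esub>"
  by (simp add: balanced_product_def)

text \<open>Allows injectivity on idempotents to be applied to \<open>e e'\<close> when the order is
  compared on both sides.\<close>

lemma idempotent_mult_closed:
  assumes "e \<in> idempotents A" "e' \<in> idempotents A"
  shows "e \<otimes> e' \<in> idempotents A"
proof -
  have e: "e \<in> carrier A" "e \<otimes> e = e" and e': "e' \<in> carrier A" "e' \<otimes> e' = e'"
    using assms by (auto simp: idempotents_def)
  have "(e \<otimes> e') \<otimes> (e \<otimes> e') = (e \<otimes> e) \<otimes> (e' \<otimes> e')"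
    using e(1) e'(1) by (simp add: A.m_ac)
  then show ?thesis
    using e e' by (simp add: idempotents_def)
qed

lemma bij_betw_idempotents: "bij_betw (\<lambda>e. cls (e, \<one>\<^bsub>G\<^esub>)) (idempotents A) (idempotents P)"
proof (rule bij_betw_imageI)
  \<comment> \<open>If \<open>e' = e u\<close> with \<open>u\<close> a unit, then
    \<open>e e' = e e u = e u = e'\<close>. By symmetry and commutativity the two idempotents are
    equal.\<close>
  have absorb: "e \<otimes> e' = e'"
    if "e \<in> idempotents A" "e' \<in> idempotents A" "cls (e, \<one>\<^bsub>G\<^esub>) = cls (e', \<one>\<^bsub>G\<^esub>)" for e e'
  proof -
    have "(e', \<one>\<^bsub>G\<^esub>) \<in> cls (e, \<one>\<^bsub>G\<^esub>)"
      using that cls_mem[of e' "\<one>\<^bsub>G\<^esub>"] by (auto simp: idempotents_def)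
    then obtain u where "u \<in> Units A" "e' = e \<otimes> u"
      by (auto simp: balanced_rel_def)
    then show ?thesis
      using that(1) by (simp add: idempotents_def A.m_assoc[symmetric] A.Units_closed)
  qed
  show "inj_on (\<lambda>e. cls (e, \<one>\<^bsub>G\<^esub>)) (idempotents A)"
  proof (rule inj_onI)
    fix e e' assume *: "e \<in> idempotents A" "e' \<in> idempotents A"
      "cls (e, \<one>\<^bsub>G\<^esub>) = cls (e', \<one>\<^bsub>G\<^esub>)"
    then have "e = e' \<otimes> e"
      using absorb[of e' e] by simp
    also have "\<dots> = e \<otimes> e'"
      using * by (simp add: idempotents_def A.m_comm)
    also have "\<dots> = e'"
      using absorb[OF *] .
    finally show "e = e'" .
  qed
  show "(\<lambda>e. cls (e, \<one>\<^bsub>G\<^esub>)) ` idempotents A = idempotents P"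
  proof (intro subset_antisym subsetI)
    fix C assume "C \<in> (\<lambda>e. cls (e, \<one>\<^bsub>G\<^esub>)) ` idempotents A"
    then show "C \<in> idempotents P"
      using cls_mult cls_in_carrier by (auto simp: idempotents_def)
  next
    fix C assume "C \<in> idempotents P"
    then have "C \<in> carrier (A \<times>\<times> G) // rel" and CC: "C \<otimes>\<^bsub>P\<^esub> C = C"
      by (auto simp: idempotents_def balanced_product_def)
    then obtain \<rho> s where \<rho>: "\<rho> \<in> carrier A" and s: "s \<in> carrier G" and C: "C = cls (\<rho>, s)"
      by (auto elim!: quotientE)
    \<comment> \<open>Among the classes whose union is \<open>C C\<close> is that of the square of
      the chosen representative; no other pair of representatives is multiplied.\<close>
    have "(\<rho> \<otimes> \<rho>, s \<otimes>\<^bsub>G\<^esub> s) \<in> C \<otimes>\<^bsub>P\<^esub> C"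
    proof -
      have "(\<rho> \<otimes> \<rho>, s \<otimes>\<^bsub>G\<^esub> s) \<in> cls ((\<rho>, s) \<otimes>\<^bsub>A \<times>\<times> G\<^esub> (\<rho>, s))"
        using \<rho> s cls_mem[of "\<rho> \<otimes> \<rho>" "s \<otimes>\<^bsub>G\<^esub> s"] by simp
      moreover have "(\<rho>, s) \<in> C"
        unfolding C using \<rho> s by (rule cls_mem)
      ultimately show ?thesis
        unfolding balanced_product_def monoid.simps by blast
    qed
    then have "((\<rho>, s), (\<rho> \<otimes> \<rho>, s \<otimes>\<^bsub>G\<^esub> s)) \<in> rel"
      using CC C by simp
    then obtain u where u: "u \<in> Units A" "\<rho> \<otimes> \<rho> = \<rho> \<otimes> u" "s \<otimes>\<^bsub>G\<^esub> s = inv\<^bsub>G\<^esub> (\<phi> u) \<otimes>\<^bsub>G\<^esub> s"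
      by (rule relE)
    have s_eq: "s = inv\<^bsub>G\<^esub> (\<phi> u)"
      using u s by (simp add: \<phi>_simps)
    \<comment> \<open>From \<open>\<rho> \<rho> = \<rho> u\<close> it follows that
      \<open>\<rho> inv u\<close> is idempotent. Acting on \<open>(e, 1)\<close> by \<open>u\<close>
      gives \<open>(e u, inv (\<phi> u))\<close>, which is \<open>(\<rho>, s)\<close>.\<close>
    define e where "e = \<rho> \<otimes> inv u"
    have e: "e \<in> carrier A" "e \<otimes> u = \<rho>"
      using \<rho> u(1) by (simp_all add: e_def A.m_assoc)
    have "e \<otimes> e = (\<rho> \<otimes> \<rho>) \<otimes> (inv u \<otimes> inv u)"
      using \<rho> u(1) by (simp add: e_def A.m_ac)
    also have "\<dots> = \<rho> \<otimes> ((u \<otimes> inv u) \<otimes> inv u)"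
      unfolding u(2) using \<rho> u(1)
      by (simp only: A.m_assoc A.m_closed A.Units_closed A.Units_inv_closed)
    also have "\<dots> = e"
      using u(1) by (simp add: e_def)
    finally have "e \<in> idempotents A"
      using e by (simp add: idempotents_def)
    moreover have "cls (e, \<one>\<^bsub>G\<^esub>) = C"
      unfolding C using e u(1) s_eq by (intro cls_eqI relI[of _ _ u]) (simp_all add: \<phi>_simps)
    ultimately show "C \<in> (\<lambda>e. cls (e, \<one>\<^bsub>G\<^esub>)) ` idempotents A"
      by blast
  qed
qed

text \<open>The bijection of idempotents preserves one, and it preserves and reflects the order:
  \<open>cls_mult\<close> turns the equation defining the order in \<open>P\<close> into an equality
  of classes, and injectivity brings it back to \<open>A\<close>. Maximality is expressed by order
  and one alone.\<close>

lemma bij_betw_maximal_idempotents: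
  "bij_betw (\<lambda>e. cls (e, \<one>\<^bsub>G\<^esub>)) (maximal_idempotents A) (maximal_idempotents P)"
proof -
  let ?h = "\<lambda>e. cls (e, \<one>\<^bsub>G\<^esub>)"
  have inj: "?h e = ?h e' \<longleftrightarrow> e = e'" if "e \<in> idempotents A" "e' \<in> idempotents A" for e e'
    using bij_betw_idempotents that by (auto simp: bij_betw_def inj_on_def)
  have one: "\<one> \<in> idempotents A"
    by (simp add: idempotents_def)
  have le: "idem_le P (?h e) (?h e') \<longleftrightarrow> idem_le A e e'"
    if "e \<in> idempotents A" "e' \<in> idempotents A" for e e'
    using that inj[OF idempotent_mult_closed[OF that] that(1)] cls_mult[of e e']
    by (simp add: idem_le_def idempotents_def)
  have idem_P: "idempotents P = ?h ` idempotents A"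
    using bij_betw_idempotents by (simp add: bij_betw_def)
  have max: "?h e \<in> maximal_idempotents P \<longleftrightarrow> e \<in> maximal_idempotents A" if "e \<in> idempotents A" for e
    using that one by (simp add: maximal_idempotents_def idem_P inj le flip: cls_one)
  have "?h ` maximal_idempotents A = maximal_idempotents P"
  proof (intro subset_antisym subsetI)
    fix C assume "C \<in> ?h ` maximal_idempotents A"
    then obtain e where "e \<in> maximal_idempotents A" "C = ?h e"
      by (rule imageE)
    then show "C \<in> maximal_idempotents P"
      using max[of e] maximal_idempotents_subset[of A] by auto
  next
    fix C assume C: "C \<in> maximal_idempotents P"
    then have "C \<in> ?h ` idempotents A"
      using maximal_idempotents_subset[of P] unfolding idem_P by (rule subsetD[rotated])
    then obtain e where "e \<in> idempotents A" "C = ?h e"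
      by (rule imageE)
    then show "C \<in> ?h ` maximal_idempotents A"
      using C max[of e] by simp
  qed
  moreover have "inj_on ?h (maximal_idempotents A)"
    using bij_betw_imp_inj_on[OF bij_betw_idempotents] maximal_idempotents_subset
    by (rule inj_on_subset)
  ultimately show ?thesis
    by (simp add: bij_betw_def)
qed

end

section \<open>The Deligne-Ribet monoid as a balanced product\<close>

lemma DR_eq_balanced_product:
  "DR artin = balanced_product Ohat Gab (\<lambda>u. finite_rec artin (Ohat_to_adeles u))"
  by (simp add: DR_def DR_rel_def balanced_product_def balanced_rel_def)

theorem corollary1p2:
  fixes artin :: "'k::number_field idele \<Rightarrow> 'k gal_elt"
  assumes "global_artin_map artin"
  shows "\<exists>f. bij_betw f (maximal_ideals :: 'k set set) (maximal_idempotents (DR artin))"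
proof -
  interpret Ohat: cring "Ohat :: ('k set \<Rightarrow> nat \<Rightarrow> 'k set) ring"
    by (rule Ohat_cring)
  interpret Gab: group "Gab :: 'k gal_elt monoid"
    by (rule group_Gab)
  interpret DR: balanced Ohat Gab "\<lambda>u. finite_rec artin (Ohat_to_adeles u)"
    using assms by unfold_locales (simp add: global_artin_map_def finite_rec_hom)
  \<comment> \<open>The composite sends \<open>\<pp>\<close> to the class of the pair consisting of
    the family that is zero at \<open>\<pp>\<close> and one elsewhere, and the identity of
    \<open>Gab\<close>.\<close>
  show ?thesis
    using bij_betw_trans[OF bij_betw_maximal_idempotents_Ohat DR.bij_betw_maximal_idempotents]
    unfolding DR_eq_balanced_product by blast
qed

end
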